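(* Let $I$ be a past interval, $E$ a Banach space, $H\subset\mathrm{Map}(I,E)$ a history space which is $C^1$-prolongable and regulated by $C^1$-prolongations, and $(\sigma_0,\psi_0)\in\mathbb{R}\times H$. Then the following statements hold: (i) Every neighborhood $W$ of $(\sigma_0,\psi_0)$ in $[\sigma_0,+\infty)\times H$ is a neighborhood by $C^1$-prolongations of $(\sigma_0,\psi_0)$. (ii) If, furthermore, the map $$\mathbb{R}_+\times E\times H\ni(t,v,\phi)\mapsto S(t)(v,\phi)\in H$$ is continuous, then every neighborhood $W$ of $(\sigma_0,\psi_0)$ in $\mathbb{R}\times H$ is a uniform neighborhood by $C^1$-prolongations of $(\sigma_0,\psi_0)$.
   Context: Basic notation. $E=(E,\|\cdot\|_E)$ is a Banach space, $\mathbb{R}_+=[0,\infty)$, $\mathbb{R}_-=(-\infty,0]$. A past interval is an interval $I\subset\mathbb{R}_-$ with $0\in I$. $\mathrm{Map}(I,E)$ is the linear space of all maps $I\to E$; $\boldsymbol 0$ is the zero map. For an interval $J$, $J+I=\{t+\theta:t\in J,\theta\in I\}$. If $\gamma$ is an $E$-valued map defined on $J+I$ and $t\in J$, then $I_t\gamma\in\mathrm{Map}(I,E)$ is $I_t\gamma(\theta)=\gamma(t+\theta)$. A history space is a linear subspace $H\subset\mathrm{Map}(I,E)$ with a topology for which the linear operations are continuous. Prolongations. For $(\sigma,\psi)\in\mathbb{R}\times\mathrm{Map}(I,E)$, a $C^1$-prolongation of $(\sigma,\psi)$ is a map $\gamma\colon J+I\to E$, where $J$ is an interval with left end point $\sigma\in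 J$ ($J=\{\sigma\}$ allowed, any such map then counting as $C^1$), with $I_\sigma\gamma=\psi$ and $\gamma|_J$ of class $C^1$ (one-sided derivatives at end points). A $C^1$-prolongation of $\psi$ is one of $(0,\psi)$. For $v\in E$, $\psi^{\wedge v}\colon\mathbb{R}_++I\to E$ is $\psi^{\wedge v}(t)=\psi(t)$ for $t\in I$ and $\psi^{\wedge v}(t)=\psi(0)+tv$ for $t\ge0$. For $t\ge0$, $S(t)(v,\phi):=I_t[\phi^{\wedge v}]$. $\|g\|_{C^1[0,T]}=\sup_{[0,T]}\|g\|_E+\sup_{[0,T]}\|g'\|_E$. For $T>0$, $0\le\delta\le\infty$, $v\in E$, $\varGamma^1_{\sigma,\psi}(T,\delta,v)$ is the set of $C^1$-prolongations $\gamma\colon[\sigma,\sigma+T]+I\to E$ of $(\sigma,\psi)$ with $\|\gamma(\sigma+\cdot)-\psi^{\wedge v}(\cdot)\|_{C^1[0,T]}\le\delta$ and $\gamma'(\sigma)=v$ (right derivative); $\varGamma^1_{\sigma,\psi}(0,\delta,v)=\{\psi(\cdot-\sigma)\colon\sigma+I\to E\}$. Put $$\varLambda^1_{\sigma,\psi}(T,\delta,v)=\bigcup_{\tau\in[0,T]}\{(\sigma+\tau,I_{\sigma+\tau}\gamma):\gamma\in\varGamma^1_{\sigma,\psi}(\tau,\delta,v)\}.$$ Properties of $H$. $H$ is $C^1$-prolongable if for every $\psi\in H$ and every $C^1$-prolongation $\gamma\colon\mathbb{R}_++I\to E$ of $\psi$ one has $I_t\gamma\in H$ for all $t\ge0$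 and $t\mapsto I_t\gamma\in H$ is continuous on $\mathbb{R}_+$. $H$ is regulated by $C^1$-prolongations if for every $T>0$ and every neighborhood $N$ of $\boldsymbol 0$ in $H$ there is $\delta>0$ with $\varLambda^1_{0,\boldsymbol 0}(T,\delta,0)\subset[0,T]\times N$. Neighborhoods. $W\subset\mathbb{R}\times H$ is a neighborhood by $C^1$-prolongations of $(\sigma_0,\psi_0)$ if for every $v\in E$ there are $T,\delta>0$ with $\varLambda^1_{\sigma_0,\psi_0}(T,\delta,v)\subset W$. It is a uniform neighborhood by $C^1$-prolongations of $(\sigma_0,\psi_0)$ if for every $v_0\in E$ there are $T,\delta>0$, a neighborhood $W_0$ of $(\sigma_0,\psi_0)$ in $W$, and a neighborhood $V_0$ of $v_0$ in $E$ with $\bigcup_{(\sigma,\psi,v)\in W_0\times V_0}\varLambda^1_{\sigma,\psi}(T,\delta,v)\subset W$. *)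

theory Defs
  imports "HOL-Analysis.Analysis"
begin

text \<open>
  A map from a set \<open>D\<close> of reals to \<open>E\<close> is an element of \<open>D \<rightarrow>\<^sub>E UNIV\<close>, i.e. a total function
  equal to \<open>undefined\<close> off \<open>D\<close>, so that equality of functions is equality of maps on \<open>D\<close>.
  The linear operations of \<open>Map(I, E)\<close> therefore have to restrict to \<open>I\<close>.
  A history space is represented by its topology, with \<open>topspace\<close> as the underlying linear subspace.
  The sum \<open>J + I\<close> of sets is the pointwise one.
\<close>

definition past_interval :: "real set \<Rightarrow> bool" where
  "past_interval I \<longleftrightarrow> is_interval I \<and> I \<subseteq> {..0} \<and> 0 \<in> I"

definition map_zero :: "real set \<Rightarrow> real \<Rightarrow> 'e::real_vector" where
  "map_zero I = (\<lambda>\<theta>\<in>I. 0)"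

definition map_add :: "real set \<Rightarrow> (real \<Rightarrow> 'e) \<Rightarrow> (real \<Rightarrow> 'e) \<Rightarrow> real \<Rightarrow> 'e::real_vector" where
  "map_add I \<phi> \<psi> = (\<lambda>\<theta>\<in>I. \<phi> \<theta> + \<psi> \<theta>)"

definition map_scale :: "real set \<Rightarrow> real \<Rightarrow> (real \<Rightarrow> 'e) \<Rightarrow> real \<Rightarrow> 'e::real_vector" where
  "map_scale I c \<phi> = (\<lambda>\<theta>\<in>I. c *\<^sub>R \<phi> \<theta>)"

definition history_space :: "real set \<Rightarrow> (real \<Rightarrow> 'e::banach) topology \<Rightarrow> bool" where
  "history_space I H \<longleftrightarrow>
     topspace H \<subseteq> (I \<rightarrow>\<^sub>E UNIV) \<and>
     map_zero I \<in> topspace H \<and>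
     (\<forall>\<phi>\<in>topspace H. \<forall>\<psi>\<in>topspace H. map_add I \<phi> \<psi> \<in> topspace H) \<and>
     (\<forall>c. \<forall>\<phi>\<in>topspace H. map_scale I c \<phi> \<in> topspace H) \<and>
     continuous_map (prod_topology H H) H (\<lambda>(\<phi>, \<psi>). map_add I \<phi> \<psi>) \<and>
     continuous_map (prod_topology euclideanreal H) H (\<lambda>(c, \<phi>). map_scale I c \<phi>)"

definition nbhd_in :: "'a topology \<Rightarrow> 'a \<Rightarrow> 'a set \<Rightarrow> bool" where
  "nbhd_in X x N \<longleftrightarrow> N \<subseteq> topspace X \<and> (\<exists>U. openin X U \<and> x \<in> U \<and> U \<subseteq> N)"

text \<open>\<open>hist I t \<gamma>\<close> is the history \<open>I\<^sub>t\<gamma>\<close>.\<close>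

definition hist :: "real set \<Rightarrow> real \<Rightarrow> (real \<Rightarrow> 'e) \<Rightarrow> real \<Rightarrow> 'e" where
  "hist I t \<gamma> = (\<lambda>\<theta>\<in>I. \<gamma> (t + \<theta>))"

text \<open>
  Derivatives are taken within \<open>J\<close>, hence one-sided at end points. For \<open>J = {\<sigma>}\<close> the filter
  \<open>at \<sigma> within J\<close> is trivial and every map is of class \<open>C\<^sup>1\<close>.
\<close>

definition C1_on :: "real set \<Rightarrow> (real \<Rightarrow> 'e::real_normed_vector) \<Rightarrow> bool" where
  "C1_on J \<gamma> \<longleftrightarrow>
     (\<exists>\<gamma>'. (\<forall>t\<in>J. (\<gamma> has_vector_derivative \<gamma>' t) (at t within J)) \<and> continuous_on J \<gamma>')"

definition C1_prolongation ::
  "real set \<Rightarrow> real \<Rightarrow> (real \<Rightarrow> 'e::real_normed_vector) \<Rightarrow> real set \<Rightarrow> (real \<Rightarrow> 'e) \<Rightarrow> bool" where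
  "C1_prolongation I \<sigma> \<psi> J \<gamma> \<longleftrightarrow>
     is_interval J \<and> \<sigma> \<in> J \<and> J \<subseteq> {\<sigma>..} \<and>
     \<gamma> \<in> (J + I \<rightarrow>\<^sub>E UNIV) \<and> hist I \<sigma> \<gamma> = \<psi> \<and> C1_on J \<gamma>"

text \<open>\<open>affine_prolong I \<psi> v\<close> is \<open>\<psi>\<close> prolonged with constant velocity \<open>v\<close>.\<close>

definition affine_prolong ::
  "real set \<Rightarrow> (real \<Rightarrow> 'e) \<Rightarrow> 'e \<Rightarrow> real \<Rightarrow> 'e::real_vector" where
  "affine_prolong I \<psi> v = (\<lambda>t\<in>{0..} + I. if t \<in> I then \<psi> t else \<psi> 0 + t *\<^sub>R v)"

definition S_map :: "real set \<Rightarrow> real \<Rightarrow> 'e \<Rightarrow> (real \<Rightarrow> 'e) \<Rightarrow> real \<Rightarrow> 'e::real_vector" where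
  "S_map I t v \<phi> = hist I t (affine_prolong I \<phi> v)"

definition C1_norm :: "real \<Rightarrow> (real \<Rightarrow> 'e::real_normed_vector) \<Rightarrow> ennreal" where
  "C1_norm T g =
     (SUP t\<in>{0..T}. ennreal (norm (g t))) +
     (SUP t\<in>{0..T}. ennreal (norm (vector_derivative g (at t within {0..T}))))"

definition Gamma1 ::
  "real set \<Rightarrow> real \<Rightarrow> (real \<Rightarrow> 'e::real_normed_vector) \<Rightarrow> real \<Rightarrow> ennreal \<Rightarrow> 'e \<Rightarrow> (real \<Rightarrow> 'e) set" where
  "Gamma1 I \<sigma> \<psi> T \<delta> v =
     (if T = 0 then {\<lambda>t\<in>{\<sigma>} + I. \<psi> (t - \<sigma>)}
      else {\<gamma>. C1_prolongation I \<sigma> \<psi> {\<sigma>..\<sigma> + T} \<gamma> \<and>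
                C1_norm T (\<lambda>t. \<gamma> (\<sigma> + t) - affine_prolong I \<psi> v t) \<le> \<delta> \<and>
                (\<gamma> has_vector_derivative v) (at \<sigma> within {\<sigma>..\<sigma> + T})})"

definition Lambda1 ::
  "real set \<Rightarrow> real \<Rightarrow> (real \<Rightarrow> 'e::real_normed_vector) \<Rightarrow> real \<Rightarrow> ennreal \<Rightarrow> 'e
    \<Rightarrow> (real \<times> (real \<Rightarrow> 'e)) set" where
  "Lambda1 I \<sigma> \<psi> T \<delta> v =
     (\<Union>\<tau>\<in>{0..T}. {(\<sigma> + \<tau>, hist I (\<sigma> + \<tau>) \<gamma>) | \<gamma>. \<gamma> \<in> Gamma1 I \<sigma> \<psi> \<tau> \<delta> v})"

definition C1_prolongable :: "real set \<Rightarrow> (real \<Rightarrow> 'e::real_normed_vector) topology \<Rightarrow> bool" where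
  "C1_prolongable I H \<longleftrightarrow>
     (\<forall>\<psi>\<in>topspace H. \<forall>\<gamma>. C1_prolongation I 0 \<psi> {0..} \<gamma> \<longrightarrow>
        (\<forall>t\<ge>0. hist I t \<gamma> \<in> topspace H) \<and>
        continuous_map (top_of_set {0..}) H (\<lambda>t. hist I t \<gamma>))"

text \<open>
  Here and below \<open>\<delta>\<close> ranges over \<open>(0, \<infinity>]\<close>; allowing \<open>\<infinity>\<close> makes no difference, as
  \<open>Lambda1\<close> is monotone in \<open>\<delta>\<close>.
\<close>

definition C1_regulated :: "real set \<Rightarrow> (real \<Rightarrow> 'e::real_normed_vector) topology \<Rightarrow> bool" where
  "C1_regulated I H \<longleftrightarrow>
     (\<forall>T>0. \<forall>N. nbhd_in H (map_zero I) N \<longrightarrow>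
        (\<exists>\<delta>>0. Lambda1 I 0 (map_zero I) T \<delta> 0 \<subseteq> {0..T} \<times> N))"

definition C1_nbhd ::
  "real set \<Rightarrow> (real \<Rightarrow> 'e::real_normed_vector) topology \<Rightarrow> real \<times> (real \<Rightarrow> 'e)
    \<Rightarrow> (real \<times> (real \<Rightarrow> 'e)) set \<Rightarrow> bool" where
  "C1_nbhd I H p W \<longleftrightarrow>
     W \<subseteq> UNIV \<times> topspace H \<and>
     (\<forall>v. \<exists>T>0. \<exists>\<delta>>0. Lambda1 I (fst p) (snd p) T \<delta> v \<subseteq> W)"

definition uniform_C1_nbhd ::
  "real set \<Rightarrow> (real \<Rightarrow> 'e::real_normed_vector) topology \<Rightarrow> real \<times> (real \<Rightarrow> 'e)
    \<Rightarrow> (real \<times> (real \<Rightarrow> 'e)) set \<Rightarrow> bool" where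
  "uniform_C1_nbhd I H p W \<longleftrightarrow>
     W \<subseteq> UNIV \<times> topspace H \<and>
     (\<forall>v\<^sub>0. \<exists>T>0. \<exists>\<delta>>0. \<exists>W\<^sub>0 V\<^sub>0.
        nbhd_in (subtopology (prod_topology euclideanreal H) W) p W\<^sub>0 \<and>
        nbhd_in euclidean v\<^sub>0 V\<^sub>0 \<and>
        (\<Union>((\<sigma>, \<psi>), v)\<in>W\<^sub>0 \<times> V\<^sub>0. Lambda1 I \<sigma> \<psi> T \<delta> v) \<subseteq> W)"

end

theory Submission
  imports Defs
begin

text \<open>
  The argument is a superposition principle.  Subtracting the affine prolongation
  \<open>\<psi>\<^sup>\<and>\<^sup>v\<close> from a prolongation \<open>\<gamma>\<close> of \<open>(\<sigma>, \<psi>)\<close> with initial velocity \<open>v\<close>, and moving the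
  starting time to \<open>0\<close>, leaves a prolongation of the zero history with initial velocity \<open>0\<close> whose
  distance from zero is the distance of \<open>\<gamma>\<close> from \<open>\<psi>\<^sup>\<and>\<^sup>v\<close>.  Hence every history reached from
  \<open>(\<sigma>, \<psi>)\<close> at time \<open>\<sigma> + \<tau>\<close> has the form \<open>S(\<tau>)(v, \<psi>) + \<zeta>\<close>, where \<open>(\<tau>, \<zeta>)\<close> is reached from
  \<open>(0, 0)\<close> (\<open>Lambda1_subset_affine_plus_perturbation\<close>).

  Since \<open>H\<close> is regulated by \<open>C\<^sup>1\<close>-prolongations, \<open>\<delta>\<close> can be chosen so that \<open>\<zeta>\<close> stays in any prescribed
  neighborhood of zero.  It remains to keep \<open>(\<sigma> + \<tau>, S(\<tau>)(v, \<psi>) + \<zeta>)\<close> in \<open>W\<close>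
  for small \<open>\<tau>\<close> and \<open>\<zeta>\<close>, which follows from continuity of addition in \<open>H\<close> and of \<open>S\<close>.  For a fixed
  \<open>(\<sigma>\<^sub>0, \<psi>\<^sub>0, v)\<close> only \<open>\<tau> \<mapsto> S(\<tau>)(v, \<psi>\<^sub>0)\<close> has to be continuous, and it is because \<open>H\<close> is
  \<open>C\<^sup>1\<close>-prolongable; the uniform version lets \<open>(\<sigma>, \<psi>, v)\<close> vary and therefore needs joint
  continuity.
\<close>

section \<open>Affine prolongations\<close>

lemma past_interval_nonpos: "past_interval I \<Longrightarrow> \<theta> \<in> I \<Longrightarrow> \<theta> \<le> 0"
  by (auto simp: past_interval_def)

lemma past_interval_zero: "past_interval I \<Longrightarrow> 0 \<in> I"
  by (simp add: past_interval_def)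

lemma affine_prolong_history:
  assumes "past_interval I" "t \<in> I"
  shows "affine_prolong I \<psi> v t = \<psi> t"
  using assms set_plus_intro[of 0 "{0..}" t I] by (simp add: affine_prolong_def)

lemma affine_prolong_nonneg:
  assumes "past_interval I" "0 \<le> t"
  shows "affine_prolong I \<psi> v t = \<psi> 0 + t *\<^sub>R v"
proof -
  have "t \<in> {0..} + I"
    using assms set_plus_intro[of t "{0..}" 0 I] by (simp add: past_interval_zero)
  moreover have "t = 0" if "t \<in> I"
    using past_interval_nonpos[OF assms(1) that] assms(2) by simp
  ultimately show ?thesis
    by (auto simp: affine_prolong_def)
qed

lemma affine_prolong_has_vector_derivative:
  assumes "past_interval I" "J \<subseteq> {0..}" "t \<in> J"
  shows "(affine_prolong I \<psi> v has_vector_derivative v) (at t within J)"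
proof -
  have "((\<lambda>t. \<psi> 0 + t *\<^sub>R v) has_vector_derivative v) (at t within J)"
    by (auto intro!: derivative_eq_intros)
  then show ?thesis
    by (rule has_vector_derivative_transform[OF assms(3), rotated])
      (use assms(1,2) in \<open>auto simp: affine_prolong_nonneg\<close>)
qed

lemma C1_prolongation_affine_prolong:
  assumes "past_interval I" "\<psi> \<in> I \<rightarrow>\<^sub>E UNIV"
  shows "C1_prolongation I 0 \<psi> {0..} (affine_prolong I \<psi> v)"
proof -
  have "hist I 0 (affine_prolong I \<psi> v) = \<psi>"
    using assms(2) by (auto simp: hist_def affine_prolong_history[OF assms(1)] PiE_def extensional_def)
  moreover have "C1_on {0..} (affine_prolong I \<psi> v)"
    unfolding C1_on_def
    by (rule exI[of _ "\<lambda>_. v"]) (simp add: affine_prolong_has_vector_derivative[OF assms(1)])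
  ultimately show ?thesis
    by (simp add: C1_prolongation_def affine_prolong_def is_interval_ci)
qed

lemma S_map_zero_time:
  fixes \<psi> :: "real \<Rightarrow> 'e::real_normed_vector"
  assumes "past_interval I" "\<psi> \<in> I \<rightarrow>\<^sub>E UNIV"
  shows "S_map I 0 v \<psi> = \<psi>"
  using C1_prolongation_affine_prolong[OF assms] by (simp add: S_map_def C1_prolongation_def)

lemma map_add_map_zero:
  assumes "\<psi> \<in> I \<rightarrow>\<^sub>E UNIV"
  shows "map_add I \<psi> (map_zero I) = \<psi>"
  using assms by (auto simp: map_add_def map_zero_def PiE_def extensional_def)

section \<open>Superposition of prolongations\<close>

lemma C1_norm_cong:
  assumes "\<And>t. t \<in> {0..T} \<Longrightarrow> f t = g t"
  shows "C1_norm T f = C1_norm T g"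
proof -
  have "vector_derivative f (at t within {0..T}) = vector_derivative g (at t within {0..T})"
    if "t \<in> {0..T}" for t
    using assms that
    by (intro vector_derivative_cong_eq) (auto simp: eventually_at_filter intro!: always_eventually)
  with assms have "(SUP t\<in>{0..T}. ennreal (norm (f t))) = (SUP t\<in>{0..T}. ennreal (norm (g t)))"
    and "(SUP t\<in>{0..T}. ennreal (norm (vector_derivative f (at t within {0..T}))))
      = (SUP t\<in>{0..T}. ennreal (norm (vector_derivative g (at t within {0..T}))))"
    by (intro SUP_cong refl; simp)+
  then show ?thesis
    by (simp add: C1_norm_def)
qed

text \<open>
  Both \<open>\<gamma>(\<sigma> + \<cdot>)\<close> and \<open>\<psi>\<^sup>\<and>\<^sup>v\<close> prolong \<open>\<psi>\<close> with initial velocity \<open>v\<close>, so their difference prolongs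
  the zero history with initial velocity zero.  The same \<open>\<delta>\<close> serves on both sides, because the affine
  prolongation of zero with velocity zero vanishes on \<open>[0, \<tau>]\<close>, so that both distances are the
  \<open>C\<^sup>1\<close>-norm of this difference.
\<close>

lemma Gamma1_minus_affine_prolong:
  assumes I: "past_interval I" and \<tau>: "\<tau> > 0" and \<gamma>: "\<gamma> \<in> Gamma1 I \<sigma> \<psi> \<tau> \<delta> v"
  shows "(\<lambda>t\<in>{0..\<tau>} + I. \<gamma> (\<sigma> + t) - affine_prolong I \<psi> v t) \<in> Gamma1 I 0 (map_zero I) \<tau> \<delta> 0"
    (is "?\<eta> \<in> _")
proof -
  have pro: "C1_prolongation I \<sigma> \<psi> {\<sigma>..\<sigma> + \<tau>} \<gamma>"
    and norm: "C1_norm \<tau> (\<lambda>t. \<gamma> (\<sigma> + t) - affine_prolong I \<psi> v t) \<le> \<delta>"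
    and v: "(\<gamma> has_vector_derivative v) (at \<sigma> within {\<sigma>..\<sigma> + \<tau>})"
    using \<gamma> \<tau> by (auto simp: Gamma1_def)
  have hist: "hist I \<sigma> \<gamma> = \<psi>"
    using pro by (simp add: C1_prolongation_def)
  obtain \<gamma>' where \<gamma>': "\<And>s. s \<in> {\<sigma>..\<sigma> + \<tau>} \<Longrightarrow>
      (\<gamma> has_vector_derivative \<gamma>' s) (at s within {\<sigma>..\<sigma> + \<tau>})"
    and cont: "continuous_on {\<sigma>..\<sigma> + \<tau>} \<gamma>'"
    using pro unfolding C1_prolongation_def C1_on_def by blast
  have dom: "t \<in> {0..\<tau>} + I" if "t \<in> {0..\<tau>}" for t
    using set_plus_intro[OF that past_interval_zero[OF I]] by simp
  have dom_I: "\<theta> \<in> {0..\<tau>} + I" if "\<theta> \<in> I" for \<theta>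
    using set_plus_intro[of 0 "{0..\<tau>}" \<theta> I] that \<tau> by simp
  have deriv: "(?\<eta> has_vector_derivative d - v) (at t within {0..\<tau>})"
    if t: "t \<in> {0..\<tau>}" and d: "(\<gamma> has_vector_derivative d) (at (\<sigma> + t) within {\<sigma>..\<sigma> + \<tau>})" for t d
  proof -
    have img: "(\<lambda>t. \<sigma> + t) ` {0..\<tau>} = {\<sigma>..\<sigma> + \<tau>}"
      by simp
    have "((\<lambda>t. \<sigma> + t) has_vector_derivative 1) (at t within {0..\<tau>})"
      by (auto intro!: derivative_eq_intros)
    from vector_diff_chain_within[OF this, of \<gamma> d] d
    have "((\<lambda>t. \<gamma> (\<sigma> + t)) has_vector_derivative d) (at t within {0..\<tau>})"
      by (simp add: o_def img del: image_add_atLeastAtMost)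
    then have "((\<lambda>t. \<gamma> (\<sigma> + t) - affine_prolong I \<psi> v t) has_vector_derivative d - v)
        (at t within {0..\<tau>})"
      by (rule has_vector_derivative_diff)
        (use affine_prolong_has_vector_derivative[OF I _ t] in auto)
    then show ?thesis
      by (rule has_vector_derivative_transform[OF t, rotated]) (simp add: dom)
  qed
  have "C1_on {0..\<tau>} ?\<eta>"
    unfolding C1_on_def
  proof (intro exI conjI ballI)
    fix t assume "t \<in> {0..\<tau>}"
    then show "(?\<eta> has_vector_derivative \<gamma>' (\<sigma> + t) - v) (at t within {0..\<tau>})"
      by (intro deriv \<gamma>') auto
  next
    show "continuous_on {0..\<tau>} (\<lambda>t. \<gamma>' (\<sigma> + t) - v)"
      by (intro continuous_intros continuous_on_compose2[OF cont]) auto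
  qed
  moreover have "hist I 0 ?\<eta> = map_zero I"
  proof -
    have "\<gamma> (\<sigma> + \<theta>) = \<psi> \<theta>" if "\<theta> \<in> I" for \<theta>
      using fun_cong[OF hist, of \<theta>] that by (simp add: hist_def)
    then show ?thesis
      by (auto simp: fun_eq_iff hist_def map_zero_def dom_I affine_prolong_history[OF I])
  qed
  ultimately have "C1_prolongation I 0 (map_zero I) {0..0 + \<tau>} ?\<eta>"
    using \<tau> by (simp add: C1_prolongation_def is_interval_cc)
  moreover have "C1_norm \<tau> (\<lambda>t. ?\<eta> (0 + t) - affine_prolong I (map_zero I) 0 t) \<le> \<delta>"
  proof -
    have "C1_norm \<tau> (\<lambda>t. ?\<eta> (0 + t) - affine_prolong I (map_zero I) 0 t)
        = C1_norm \<tau> (\<lambda>t. \<gamma> (\<sigma> + t) - affine_prolong I \<psi> v t)"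
      by (rule C1_norm_cong)
        (simp add: dom affine_prolong_nonneg[OF I] map_zero_def past_interval_zero[OF I])
    with norm show ?thesis by simp
  qed
  moreover have "(?\<eta> has_vector_derivative 0) (at 0 within {0..0 + \<tau>})"
    using deriv[of 0 v] v \<tau> by simp
  ultimately show ?thesis
    using \<tau> by (simp add: Gamma1_def)
qed

lemma hist_eq_S_map_plus:
  assumes "0 \<le> \<tau>"
  shows "hist I (\<sigma> + \<tau>) \<gamma> =
    map_add I (S_map I \<tau> v \<psi>) (hist I \<tau> (\<lambda>t\<in>{0..\<tau>} + I. \<gamma> (\<sigma> + t) - affine_prolong I \<psi> v t))"
  using assms
  by (auto simp: hist_def map_add_def S_map_def fun_eq_iff set_plus_intro add.assoc)

text \<open>
  Taking the history at time \<open>\<tau>\<close> is linear, so the splitting of \<open>\<gamma>\<close> into its affine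
  part and a perturbation passes to histories.  The perturbation depends on \<open>\<sigma>\<close>, \<open>\<psi>\<close> and \<open>v\<close>, but the set it
  is taken from does not; this is what makes uniform estimates possible.
\<close>

lemma Lambda1_subset_affine_plus_perturbation:
  fixes \<psi> :: "real \<Rightarrow> 'e::real_normed_vector"
  assumes I: "past_interval I" and \<psi>: "\<psi> \<in> I \<rightarrow>\<^sub>E UNIV"
    and p: "p \<in> Lambda1 I \<sigma> \<psi> T \<delta> v"
  obtains \<tau> \<zeta> where "(\<tau>, \<zeta>) \<in> Lambda1 I 0 (map_zero I) T \<delta> 0"
    and "p = (\<sigma> + \<tau>, map_add I (S_map I \<tau> v \<psi>) \<zeta>)"
proof -
  obtain \<tau> \<gamma> where \<tau>: "0 \<le> \<tau>" "\<tau> \<le> T" and \<gamma>: "\<gamma> \<in> Gamma1 I \<sigma> \<psi> \<tau> \<delta> v"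
    and p_eq: "p = (\<sigma> + \<tau>, hist I (\<sigma> + \<tau>) \<gamma>)"
    using p by (auto simp: Lambda1_def)
  \<comment> \<open>At \<open>\<tau> = 0\<close> there is neither a velocity nor a distance condition, and \<open>\<gamma>\<close> is \<open>\<psi>\<close> shifted by \<open>\<sigma>\<close>.\<close>
  show thesis
  proof (cases "\<tau> = 0")
    case True
    have "hist I \<sigma> \<gamma> = \<psi>"
      using \<gamma> \<psi> True
      by (auto simp: Gamma1_def hist_def fun_eq_iff PiE_def extensional_def set_plus_intro)
    then have "p = (\<sigma> + 0, map_add I (S_map I 0 v \<psi>) (map_zero I))"
      by (simp add: p_eq True S_map_zero_time[OF I \<psi>] map_add_map_zero[OF \<psi>])
    moreover have "(0, map_zero I) \<in> Lambda1 I 0 (map_zero I) T \<delta> (0::'e)"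
    proof -
      have "hist I 0 (\<lambda>t\<in>{0} + I. map_zero I (t - 0)) = (map_zero I :: real \<Rightarrow> 'e)"
        by (auto simp: hist_def map_zero_def fun_eq_iff)
      with \<tau> show ?thesis
        unfolding Lambda1_def by (intro UN_I[of 0]) (simp_all add: Gamma1_def)
    qed
    ultimately show thesis by (intro that)
  next
    case False
    let ?\<eta> = "\<lambda>t\<in>{0..\<tau>} + I. \<gamma> (\<sigma> + t) - affine_prolong I \<psi> v t"
    have "?\<eta> \<in> Gamma1 I 0 (map_zero I) \<tau> \<delta> 0"
      using \<tau> False \<gamma> by (intro Gamma1_minus_affine_prolong[OF I]) auto
    then have "(0 + \<tau>, hist I (0 + \<tau>) ?\<eta>) \<in> Lambda1 I 0 (map_zero I) T \<delta> 0"
      using \<tau> unfolding Lambda1_def by auto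
    then show thesis
      by (intro that[of \<tau> "hist I \<tau> ?\<eta>"]) (auto simp: p_eq hist_eq_S_map_plus[OF \<tau>(1)])
  qed
qed

section \<open>Neighborhoods in history spaces\<close>

lemma continuous_map_map_add:
  assumes "history_space I H" "continuous_map X H f" "continuous_map X H g"
  shows "continuous_map X H (\<lambda>x. map_add I (f x) (g x))"
proof -
  have "continuous_map X (prod_topology H H) (\<lambda>x. (f x, g x))"
    using assms(2,3) by (simp add: continuous_map_pairedI)
  moreover have "continuous_map (prod_topology H H) H (\<lambda>(\<phi>, \<psi>). map_add I \<phi> \<psi>)"
    using assms(1) by (simp add: history_space_def)
  ultimately show ?thesis
    using continuous_map_compose by (fastforce simp: o_def)
qed

lemma continuous_map_fst_component:
  "continuous_map X (prod_topology Y Z) f \<Longrightarrow> continuous_map X Y (\<lambda>x. fst (f x))"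
  by (simp add: continuous_map_pairwise o_def)

lemma continuous_map_snd_component:
  "continuous_map X (prod_topology Y Z) f \<Longrightarrow> continuous_map X Z (\<lambda>x. snd (f x))"
  by (simp add: continuous_map_pairwise o_def)

lemma openin_halfline_contains_interval:
  fixes G :: "real set"
  assumes "openin (top_of_set {0..}) G" "0 \<in> G"
  obtains T where "T > 0" "{0..T} \<subseteq> G"
proof -
  from assms obtain e where "e > 0" and e: "\<And>t. t \<in> {0..} \<Longrightarrow> dist t 0 < e \<Longrightarrow> t \<in> G"
    by (auto simp: openin_euclidean_subtopology_iff)
  show thesis
    by (rule that[of "e / 2"]) (use \<open>e > 0\<close> in \<open>auto intro!: e simp: dist_real_def\<close>)
qed

lemma C1_regulated_neighborhood:
  assumes "history_space I H" "C1_regulated I H" "T > 0" "openin H N" "map_zero I \<in> N"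
  obtains \<delta> where "\<delta> > 0" "Lambda1 I 0 (map_zero I) T \<delta> 0 \<subseteq> {0..T} \<times> N"
proof -
  have "nbhd_in H (map_zero I) N"
    using assms(4,5) openin_subset[of H N] by (auto simp: nbhd_in_def)
  then show thesis
    using assms(2,3) that by (auto simp: C1_regulated_def)
qed

text \<open>
  The map \<open>(t, \<zeta>) \<mapsto> (\<sigma> + t, S(t)(v, \<psi>) + \<zeta>)\<close> is continuous and sends \<open>(0, 0)\<close> to \<open>(\<sigma>, \<psi>)\<close>, so it
  sends some box \<open>[0, T] \<times> N\<close> into \<open>W\<close>; regulation of \<open>H\<close> provides the \<open>\<delta>\<close> that confines the
  perturbations to \<open>N\<close>.  Continuity in \<open>t\<close> comes from prolongability, applied to the prolongation
  \<open>\<psi>\<^sup>\<and>\<^sup>v\<close>.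
\<close>

lemma neighborhood_by_C1_prolongations:
  assumes I: "past_interval I" and H: "history_space I H"
    and prolongable: "C1_prolongable I H" and regulated: "C1_regulated I H"
    and \<psi>: "\<psi> \<in> topspace H"
    and W: "nbhd_in (prod_topology (top_of_set {\<sigma>..}) H) (\<sigma>, \<psi>) W"
  shows "C1_nbhd I H (\<sigma>, \<psi>) W"
proof -
  have \<psi>I: "\<psi> \<in> I \<rightarrow>\<^sub>E UNIV"
    using H \<psi> by (auto simp: history_space_def)
  obtain U where U: "openin (prod_topology (top_of_set {\<sigma>..}) H) U" "(\<sigma>, \<psi>) \<in> U" "U \<subseteq> W"
    using W by (auto simp: nbhd_in_def)
  have "\<exists>T>0. \<exists>\<delta>>0. Lambda1 I \<sigma> \<psi> T \<delta> v \<subseteq> W" for v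
  proof -
    let ?X = "prod_topology (top_of_set {0::real..}) H"
    let ?F = "\<lambda>(t, \<zeta>). (\<sigma> + t, map_add I (S_map I t v \<psi>) \<zeta>)"
    have S: "continuous_map (top_of_set {0..}) H (\<lambda>t. S_map I t v \<psi>)"
      using prolongable \<psi> C1_prolongation_affine_prolong[OF I \<psi>I, of v]
      by (auto simp: C1_prolongable_def S_map_def)
    have "continuous_map ?X H (\<lambda>x. S_map I (fst x) v \<psi>)"
      using continuous_map_compose[OF continuous_map_fst S] by (simp add: o_def)
    then have add: "continuous_map ?X H (\<lambda>x. map_add I (S_map I (fst x) v \<psi>) (snd x))"
      by (intro continuous_map_map_add[OF H] continuous_map_snd)
    have shift: "continuous_map (top_of_set {0..}) (top_of_set {\<sigma>..}) (\<lambda>t. \<sigma> + t)"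
      by (auto intro!: continuous_intros)
    have "continuous_map ?X (top_of_set {\<sigma>..}) (\<lambda>x. \<sigma> + fst x)"
      using continuous_map_compose[OF continuous_map_fst shift] by (simp add: o_def)
    with add have F: "continuous_map ?X (prod_topology (top_of_set {\<sigma>..}) H) ?F"
      by (simp add: continuous_map_pairedI case_prod_unfold)
    have "openin ?X {x \<in> topspace ?X. ?F x \<in> U}"
      using openin_continuous_map_preimage[OF F U(1)] .
    moreover have "(0, map_zero I) \<in> {x \<in> topspace ?X. ?F x \<in> U}"
      using U(2) H by (simp add: S_map_zero_time[OF I \<psi>I] map_add_map_zero[OF \<psi>I] history_space_def)
    ultimately obtain G N where G: "openin (top_of_set {0..}) G" "0 \<in> G"
      and N: "openin H N" "map_zero I \<in> N"
      and GN: "G \<times> N \<subseteq> {x \<in> topspace ?X. ?F x \<in> U}"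
      unfolding openin_prod_topology_alt by meson
    obtain T where T: "T > 0" "{0..T} \<subseteq> G"
      using openin_halfline_contains_interval[OF G] .
    obtain \<delta> where \<delta>: "\<delta> > 0" "Lambda1 I 0 (map_zero I) T \<delta> (0::'a) \<subseteq> {0..T} \<times> N"
      using C1_regulated_neighborhood[OF H regulated T(1) N] .
    have "Lambda1 I \<sigma> \<psi> T \<delta> v \<subseteq> W"
    proof
      fix p assume "p \<in> Lambda1 I \<sigma> \<psi> T \<delta> v"
      then obtain \<tau> \<zeta> where "(\<tau>, \<zeta>) \<in> Lambda1 I 0 (map_zero I) T \<delta> 0" "p = ?F (\<tau>, \<zeta>)"
        by (auto elim!: Lambda1_subset_affine_plus_perturbation[OF I \<psi>I])
      moreover from this have "(\<tau>, \<zeta>) \<in> G \<times> N"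
        using \<delta>(2) T(2) by blast
      ultimately show "p \<in> W"
        using GN U(3) by blast
    qed
    with T(1) \<delta>(1) show ?thesis by blast
  qed
  moreover have "W \<subseteq> UNIV \<times> topspace H"
    using W by (auto simp: nbhd_in_def)
  ultimately show ?thesis
    by (simp add: C1_nbhd_def)
qed

text \<open>
  The same argument with \<open>\<sigma>\<close>, \<open>\<phi>\<close> and \<open>v\<close> as further arguments of the map: a box around
  \<open>(\<sigma>\<^sub>0, \<psi>\<^sub>0, v\<^sub>0, 0, 0)\<close> in the preimage of \<open>W\<close> yields \<open>W\<^sub>0\<close>, \<open>V\<^sub>0\<close>, \<open>T\<close> and \<open>N\<close>
  simultaneously, and \<open>\<delta>\<close> depends only on \<open>T\<close> and \<open>N\<close>.
\<close>

lemma uniform_neighborhood_by_C1_prolongations: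
  fixes H :: "(real \<Rightarrow> 'e::banach) topology"
  assumes I: "past_interval I" and H: "history_space I H"
    and regulated: "C1_regulated I H"
    and S: "continuous_map (prod_topology (top_of_set {0..}) (prod_topology euclidean H)) H
            (\<lambda>(t, v, \<phi>). S_map I t v \<phi>)"
    and \<psi>\<^sub>0: "\<psi>\<^sub>0 \<in> topspace H"
    and W: "nbhd_in (prod_topology euclideanreal H) (\<sigma>\<^sub>0, \<psi>\<^sub>0) W"
  shows "uniform_C1_nbhd I H (\<sigma>\<^sub>0, \<psi>\<^sub>0) W"
proof -
  have topI: "\<phi> \<in> I \<rightarrow>\<^sub>E UNIV" if "\<phi> \<in> topspace H" for \<phi>
    using H that by (auto simp: history_space_def)
  have WH: "W \<subseteq> topspace (prod_topology euclideanreal H)"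
    using W by (simp add: nbhd_in_def)
  obtain U where U: "openin (prod_topology euclideanreal H) U" "(\<sigma>\<^sub>0, \<psi>\<^sub>0) \<in> U" "U \<subseteq> W"
    using W by (auto simp: nbhd_in_def)
  have "\<exists>T>0. \<exists>\<delta>>0. \<exists>W\<^sub>0 V\<^sub>0.
      nbhd_in (subtopology (prod_topology euclideanreal H) W) (\<sigma>\<^sub>0, \<psi>\<^sub>0) W\<^sub>0 \<and>
      nbhd_in euclidean v\<^sub>0 V\<^sub>0 \<and>
      (\<Union>((\<sigma>, \<psi>), v)\<in>W\<^sub>0 \<times> V\<^sub>0. Lambda1 I \<sigma> \<psi> T \<delta> v) \<subseteq> W" for v\<^sub>0
  proof -
    let ?Y = "prod_topology (prod_topology euclideanreal H) (euclidean :: 'e topology)"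
    let ?X = "prod_topology ?Y (prod_topology (top_of_set {0::real..}) H)"
    let ?F = "\<lambda>(((\<sigma>, \<phi>), v), (t, \<zeta>)). (\<sigma> + t, map_add I (S_map I t v \<phi>) \<zeta>)"
    have x: "continuous_map ?X ?X (\<lambda>x. x)"
      by simp
    note \<sigma> = x[THEN continuous_map_fst_component, THEN continuous_map_fst_component,
        THEN continuous_map_fst_component]
      and \<phi> = x[THEN continuous_map_fst_component, THEN continuous_map_fst_component,
        THEN continuous_map_snd_component]
      and v = x[THEN continuous_map_fst_component, THEN continuous_map_snd_component]
      and t = x[THEN continuous_map_snd_component, THEN continuous_map_fst_component]
      and \<zeta> = x[THEN continuous_map_snd_component, THEN continuous_map_snd_component]
    have "continuous_map ?X (prod_topology (top_of_set {0..}) (prod_topology euclidean H))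
        (\<lambda>x. (fst (snd x), snd (fst x), snd (fst (fst x))))"
      by (intro continuous_map_pairedI t v \<phi>)
    from continuous_map_compose[OF this S]
    have "continuous_map ?X H (\<lambda>x. S_map I (fst (snd x)) (snd (fst x)) (snd (fst (fst x))))"
      by (simp add: o_def)
    then have add: "continuous_map ?X H
        (\<lambda>x. map_add I (S_map I (fst (snd x)) (snd (fst x)) (snd (fst (fst x)))) (snd (snd x)))"
      using \<zeta> by (intro continuous_map_map_add[OF H])
    have "continuous_map ?X euclideanreal (\<lambda>x. fst (fst (fst x)) + fst (snd x))"
      using t by (intro continuous_map_add \<sigma>) (simp add: continuous_map_in_subtopology)
    with add have F: "continuous_map ?X (prod_topology euclideanreal H) ?F"
      by (simp add: continuous_map_pairedI case_prod_unfold)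
    have F0: "?F (((\<sigma>, \<phi>), v), (0, map_zero I)) = (\<sigma>, \<phi>)" if "\<phi> \<in> topspace H" for \<sigma> \<phi> v
      using topI[OF that] by (simp add: S_map_zero_time[OF I] map_add_map_zero)
    have "openin ?X {x \<in> topspace ?X. ?F x \<in> U}"
      using openin_continuous_map_preimage[OF F U(1)] .
    moreover have "(((\<sigma>\<^sub>0, \<psi>\<^sub>0), v\<^sub>0), (0, map_zero I)) \<in> {x \<in> topspace ?X. ?F x \<in> U}"
      using F0[OF \<psi>\<^sub>0, of \<sigma>\<^sub>0 v\<^sub>0] U(2) \<psi>\<^sub>0 H by (simp add: history_space_def)
    ultimately obtain A B where A: "openin ?Y A" "((\<sigma>\<^sub>0, \<psi>\<^sub>0), v\<^sub>0) \<in> A"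
      and B: "openin (prod_topology (top_of_set {0::real..}) H) B" "(0, map_zero I) \<in> B"
      and AB: "A \<times> B \<subseteq> {x \<in> topspace ?X. ?F x \<in> U}"
      unfolding openin_prod_topology_alt[of ?Y] by meson
    obtain W\<^sub>0 V\<^sub>0 where W\<^sub>0: "openin (prod_topology euclideanreal H) W\<^sub>0" "(\<sigma>\<^sub>0, \<psi>\<^sub>0) \<in> W\<^sub>0"
      and V\<^sub>0: "openin euclidean V\<^sub>0" "v\<^sub>0 \<in> V\<^sub>0" and WV: "W\<^sub>0 \<times> V\<^sub>0 \<subseteq> A"
      using A unfolding openin_prod_topology_alt[of "prod_topology euclideanreal H"] by meson
    obtain G N where G: "openin (top_of_set {0..}) G" "0 \<in> G"
      and N: "openin H N" "map_zero I \<in> N" and GN: "G \<times> N \<subseteq> B"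
      using B unfolding openin_prod_topology_alt by meson
    have mem: "?F (((\<sigma>, \<phi>), v), (t, \<zeta>)) \<in> U"
      if "(\<sigma>, \<phi>) \<in> W\<^sub>0" "v \<in> V\<^sub>0" "t \<in> G" "\<zeta> \<in> N" for \<sigma> \<phi> v t \<zeta>
      using that AB WV GN by blast
    obtain T where T: "T > 0" "{0..T} \<subseteq> G"
      using openin_halfline_contains_interval[OF G] .
    obtain \<delta> where \<delta>: "\<delta> > 0" "Lambda1 I 0 (map_zero I) T \<delta> (0::'e) \<subseteq> {0..T} \<times> N"
      using C1_regulated_neighborhood[OF H regulated T(1) N] .
    have W\<^sub>0H: "\<phi> \<in> topspace H" if "(\<sigma>, \<phi>) \<in> W\<^sub>0" for \<sigma> \<phi>
      using openin_subset[OF W\<^sub>0(1)] that by auto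
    \<comment> \<open>Staying put is one of the allowed motions: \<open>t = 0\<close>, \<open>\<zeta> = 0\<close> gives back \<open>(\<sigma>, \<phi>)\<close> itself.\<close>
    have "W\<^sub>0 \<subseteq> W"
    proof clarify
      fix \<sigma> \<phi> assume "(\<sigma>, \<phi>) \<in> W\<^sub>0"
      with mem[OF this V\<^sub>0(2) G(2) N(2)] F0[OF W\<^sub>0H] U(3) show "(\<sigma>, \<phi>) \<in> W"
        by auto
    qed
    then have "nbhd_in (subtopology (prod_topology euclideanreal H) W) (\<sigma>\<^sub>0, \<psi>\<^sub>0) W\<^sub>0"
      using W\<^sub>0 WH unfolding nbhd_in_def openin_subtopology topspace_subtopology by blast
    moreover have "nbhd_in euclidean v\<^sub>0 V\<^sub>0"
      using V\<^sub>0 by (auto simp: nbhd_in_def)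
    moreover have "Lambda1 I \<sigma> \<phi> T \<delta> v \<subseteq> W" if W\<^sub>0': "(\<sigma>, \<phi>) \<in> W\<^sub>0" and V\<^sub>0': "v \<in> V\<^sub>0" for \<sigma> \<phi> v
    proof
      fix p assume "p \<in> Lambda1 I \<sigma> \<phi> T \<delta> v"
      then obtain \<tau> \<zeta> where \<tau>: "(\<tau>, \<zeta>) \<in> Lambda1 I 0 (map_zero I) T \<delta> 0"
        and p: "p = (\<sigma> + \<tau>, map_add I (S_map I \<tau> v \<phi>) \<zeta>)"
        by (rule Lambda1_subset_affine_plus_perturbation[OF I topI[OF W\<^sub>0H[OF W\<^sub>0']]])
      have "\<tau> \<in> G" "\<zeta> \<in> N"
        using \<tau> \<delta>(2) T(2) by blast+
      from mem[OF W\<^sub>0' V\<^sub>0' this] U(3) show "p \<in> W"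
        by (auto simp: p)
    qed
    then have "(\<Union>((\<sigma>, \<psi>), v)\<in>W\<^sub>0 \<times> V\<^sub>0. Lambda1 I \<sigma> \<psi> T \<delta> v) \<subseteq> W"
      by (intro UN_least) auto
    ultimately show ?thesis
      using T(1) \<delta>(1) by blast
  qed
  moreover have "W \<subseteq> UNIV \<times> topspace H"
    using WH by auto
  ultimately show ?thesis
    by (simp add: uniform_C1_nbhd_def)
qed

theorem theorem3p16:
  fixes I :: "real set"
    and H :: "(real \<Rightarrow> 'e::banach) topology"
    and \<sigma>\<^sub>0 :: real
    and \<psi>\<^sub>0 :: "real \<Rightarrow> 'e"
  assumes "past_interval I"
    and "history_space I H"
    and "C1_prolongable I H"
    and "C1_regulated I H"
    and "\<psi>\<^sub>0 \<in> topspace H"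
  shows "(\<forall>W. nbhd_in (prod_topology (top_of_set {\<sigma>\<^sub>0..}) H) (\<sigma>\<^sub>0, \<psi>\<^sub>0) W
            \<longrightarrow> C1_nbhd I H (\<sigma>\<^sub>0, \<psi>\<^sub>0) W) \<and>
         (continuous_map
            (prod_topology (top_of_set {0..}) (prod_topology euclidean H)) H
            (\<lambda>(t, v, \<phi>). S_map I t v \<phi>)
          \<longrightarrow> (\<forall>W. nbhd_in (prod_topology euclideanreal H) (\<sigma>\<^sub>0, \<psi>\<^sub>0) W
                \<longrightarrow> uniform_C1_nbhd I H (\<sigma>\<^sub>0, \<psi>\<^sub>0) W))"
  using neighborhood_by_C1_prolongations[OF assms]
    uniform_neighborhood_by_C1_prolongations[OF assms(1,2,4) _ assms(5)]
  by blast

end
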